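(* Let $\pi_1,\pi_2$ be possibility distributions on a finite set $\mathcal{X}$, with induced possibility measures $\Pi_1,\Pi_2$. Let $\overline{P}(A)=\min\{\Pi_1(A),\Pi_2(A)\}$ for all $A\subseteq\mathcal{X}$, and let $\overline{E}$ denote the natural extension of $\overline{P}$. Define $\pi(x)=\min\{\pi_1(x),\pi_2(x)\}=\overline{P}(\{x\})$ for $x\in\mathcal{X}$ and $\Pi(A)=\max_{x\in A}\pi(x)$ for $A\subseteq\mathcal{X}$. The following statements hold. (a) $\overline{P}\ge\Pi$. (b) $\Pi$ is normed if and only if there is an $x\in\mathcal{X}$ such that $\overline{P}(\{x\})=1$. In that case, $\overline{P}$ avoids sure loss and $\overline{P}\ge\overline{E}\ge\Pi$. (c) $\overline{P}$ is a possibility measure if and only if $\overline{P}=\Pi$. (d) $\overline{E}$ is a possibility measure if and only if $\overline{E}=\Pi$.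
   Context: $\mathcal{X}$ is a finite set and $\wp(\mathcal{X})$ its power set. A possibility distribution on $\mathcal{X}$ is a function $\varpi\colon\mathcal{X}\to[0,1]$ with $\max_{x\in\mathcal{X}}\varpi(x)=1$. It induces the possibility measure $A\mapsto\max_{x\in A}\varpi(x)$ on $\wp(\mathcal{X})$. A maximum over the empty set is taken to be $0$. A set function is called a possibility measure if it is induced in this way by some possibility distribution (so possibility measures take the value $1$ on $\mathcal{X}$). The set function $\Pi$ in the claim is called normed if $\Pi(\mathcal{X})=\max_{x\in\mathcal{X}}\pi(x)=1$; it is not assumed to be normed. An upper probability is a function $\overline{P}\colon\wp(\mathcal{X})\to[0,1]$. Its credal set $\mathcal{M}$ is the set of all (finitely additive) probability measures $Q$ on $\wp(\mathcal{X})$ with $Q(A)\le\overline{P}(A)$ for all $A\subseteq\mathcal{X}$. $\overline{P}$ avoids sure loss if $\mathcal{M}\neq\emptyset$; in that case its natural extension is $\overline{E}(A)=\max_{Q\in\mathcal{M}}Q(A)$ for $A\subseteq\mathcal{X}$. In (d), both sides of the equivalence are understood to include that $\overline{P}$ avoids sure loss, so that $\overline{E}$ exists. Inequalities between set functions are pointwise on $\wp(\mathcal{X})$. *)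

theory Defs
  imports "HOL-Analysis.Analysis"
begin

text \<open>Set functions on the power set of a finite carrier \<open>X\<close> are modelled as total functions of type
  \<open>'a set \<Rightarrow> real\<close>; only their values on subsets of \<open>X\<close> are meaningful.\<close>

definition max_over :: "('a \<Rightarrow> real) \<Rightarrow> 'a set \<Rightarrow> real" where
  "max_over f A = (if A = {} then 0 else Max (f ` A))"

definition possibility_distribution :: "'a set \<Rightarrow> ('a \<Rightarrow> real) \<Rightarrow> bool" where
  "possibility_distribution X p \<longleftrightarrow> (\<forall>x\<in>X. p x \<in> {0..1}) \<and> max_over p X = 1"

definition possibility_measure :: "'a set \<Rightarrow> ('a set \<Rightarrow> real) \<Rightarrow> bool" where
  "possibility_measure X F \<longleftrightarrow>
     (\<exists>p. possibility_distribution X p \<and> (\<forall>A\<subseteq>X. F A = max_over p A))"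

definition normed :: "'a set \<Rightarrow> ('a set \<Rightarrow> real) \<Rightarrow> bool" where
  "normed X F \<longleftrightarrow> F X = 1"

definition finitely_additive_probability :: "'a set \<Rightarrow> ('a set \<Rightarrow> real) \<Rightarrow> bool" where
  "finitely_additive_probability X Q \<longleftrightarrow>
     (\<forall>A\<subseteq>X. 0 \<le> Q A) \<and> Q X = 1 \<and>
     (\<forall>A B. A \<subseteq> X \<longrightarrow> B \<subseteq> X \<longrightarrow> A \<inter> B = {} \<longrightarrow> Q (A \<union> B) = Q A + Q B)"

definition credal_set :: "'a set \<Rightarrow> ('a set \<Rightarrow> real) \<Rightarrow> ('a set \<Rightarrow> real) set" where
  "credal_set X P = {Q. finitely_additive_probability X Q \<and> (\<forall>A\<subseteq>X. Q A \<le> P A)}"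

definition avoids_sure_loss :: "'a set \<Rightarrow> ('a set \<Rightarrow> real) \<Rightarrow> bool" where
  "avoids_sure_loss X P \<longleftrightarrow> credal_set X P \<noteq> {}"

text \<open>The credal set is in general infinite, so \<open>Max\<close> (which is for finite sets only) cannot be used.
  \<open>GREATEST\<close> denotes an attained maximum. The value is only meaningful if \<open>P\<close> avoids sure loss.\<close>

definition natural_extension :: "'a set \<Rightarrow> ('a set \<Rightarrow> real) \<Rightarrow> 'a set \<Rightarrow> real" where
  "natural_extension X P A = (GREATEST v. \<exists>Q\<in>credal_set X P. v = Q A)"

end

theory Submission
  imports Defs
begin

text \<open>Everything rests on comparing set functions on singletons. A possibility measure is
  determined by its values there, and both the minimum \<open>P\<close> of the two given possibility measures and
  its natural extension \<open>E\<close> are bounded on \<open>{x}\<close> by \<open>\<pi> x\<close>, the first with equality. So if \<open>P\<close> is a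
  possibility measure, its distribution is \<open>\<pi>\<close>.

  For \<open>E\<close>, which is meaningful when \<open>P\<close> avoids sure loss, one also needs
  \<open>E \<ge> Poss\<close>, which holds once \<open>Poss\<close> is normed. Then some \<open>z\<close> has
  \<open>\<pi> z = 1\<close>; for a point \<open>y\<close> of \<open>A\<close> where \<open>\<pi>\<close> is largest, the probability measure with mass
  \<open>\<pi> y\<close> at \<open>y\<close> and the remaining mass at \<open>z\<close> is dominated by \<open>Poss \<le> P\<close> and gives \<open>A\<close> at least
  \<open>Poss A\<close> (lemma \<open>credal_set_attains_max_over\<close>). If \<open>E\<close> is a possibility measure, it takes the value
  1 on some singleton \<open>{x}\<close>, hence \<open>\<pi> x \<ge> 1\<close> and \<open>Poss\<close> is normed, so that
  \<open>Poss \<le> E \<le> Poss\<close>. In the converse directions, \<open>P X = 1\<close> and \<open>E X = 1\<close> say that \<open>\<pi>\<close> has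
  maximum 1.

  The analytic ingredient is that the maximum defining \<open>E\<close> is attained, since a \<open>GREATEST\<close>
  without a greatest value would tell nothing. It is, because a credal set, with all values kept in
  the unit interval, is compact in the topology of pointwise convergence (lemma
  \<open>natural_extension_attained\<close>).\<close>

section \<open>Maxima over finite sets and possibility measures\<close>

lemma max_over_cong:
  assumes "\<And>x. x \<in> A \<Longrightarrow> f x = g x"
  shows "max_over f A = max_over g A"
  using assms by (simp add: max_over_def cong: image_cong_simp)

lemma max_over_singleton [simp]: "max_over f {x} = f x"
  by (simp add: max_over_def)

lemma max_over_upper:
  assumes "finite A" "x \<in> A"
  shows "f x \<le> max_over f A"
  using assms by (auto simp: max_over_def)

lemma max_over_attained:
  assumes "finite A" "A \<noteq> {}"
  obtains x where "x \<in> A" "max_over f A = f x"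
proof -
  have "Max (f ` A) \<in> f ` A"
    using assms by (intro Max_in) auto
  then obtain x where "x \<in> A" "Max (f ` A) = f x"
    by blast
  with that assms(2) show thesis
    by (simp add: max_over_def)
qed

lemma max_over_mono:
  assumes "finite A" "\<And>x. x \<in> A \<Longrightarrow> f x \<le> g x"
  shows "max_over f A \<le> max_over g A"
proof (cases "A = {}")
  case True
  then show ?thesis by (simp add: max_over_def)
next
  case False
  then obtain x where "x \<in> A" "max_over f A = f x"
    using assms(1) max_over_attained by blast
  then show ?thesis
    using assms max_over_upper[of A x g] by (metis order_trans)
qed

lemma max_over_nonneg:
  assumes "finite A" "\<And>x. x \<in> A \<Longrightarrow> 0 \<le> f x"
  shows "0 \<le> max_over f A"
proof -
  have "max_over (\<lambda>_. 0) A = 0"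
    by (simp add: max_over_def image_constant_conv)
  then show ?thesis
    using max_over_mono[of A "\<lambda>_. 0" f] assms by simp
qed

lemma possibility_distribution_carrier_nonempty:
  "possibility_distribution X p \<Longrightarrow> X \<noteq> {}"
  by (auto simp: possibility_distribution_def max_over_def)

lemma possibility_measure_eq_max_over_singletons:
  assumes "possibility_measure X F" "A \<subseteq> X"
  shows "F A = max_over (\<lambda>x. F {x}) A"
proof -
  obtain p where F: "\<And>B. B \<subseteq> X \<Longrightarrow> F B = max_over p B"
    using assms(1) by (auto simp: possibility_measure_def)
  have "F {x} = p x" if "x \<in> A" for x
    using F[of "{x}"] that assms(2) by auto
  then show ?thesis
    using F[OF assms(2)] max_over_cong[of A p "\<lambda>x. F {x}"] by simp
qed

lemma possibility_measure_carrier: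
  assumes "possibility_measure X F"
  shows "F X = 1"
  using assms by (auto simp: possibility_measure_def possibility_distribution_def)

section \<open>Compactness of credal sets\<close>

lemma finitely_additive_probability_le_1:
  assumes "finitely_additive_probability X Q" "A \<subseteq> X"
  shows "Q A \<le> 1"
proof -
  have additive: "\<And>B C. B \<subseteq> X \<Longrightarrow> C \<subseteq> X \<Longrightarrow> B \<inter> C = {} \<Longrightarrow> Q (B \<union> C) = Q B + Q C"
    using assms(1) unfolding finitely_additive_probability_def by metis
  have "Q (A \<union> (X - A)) = Q A + Q (X - A)"
    using assms(2) by (intro additive) auto
  moreover have "0 \<le> Q (X - A)" "Q X = 1"
    using assms by (auto simp: finitely_additive_probability_def)
  ultimately show ?thesis
    using assms(2) by (simp add: Un_absorb1)
qed

lemma closed_credal_set: "closed (credal_set X P)"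
  unfolding credal_set_def finitely_additive_probability_def
  by (intro closed_Collect_conj closed_Collect_all closed_Collect_imp open_Collect_const
      closed_Collect_le closed_Collect_eq continuous_on_const continuous_on_add
      continuous_on_product_coordinates)

text \<open>The credal set is closed, but values outside the power set of \<open>X\<close> may be arbitrary; it becomes
  compact once all values are confined to the unit interval. This loses nothing:
  resetting the irrelevant values to 0 stays in the credal set. Continuity of evaluation at \<open>A\<close> then yields a maximizer.\<close>

lemma natural_extension_attained:
  assumes "avoids_sure_loss X P" "A \<subseteq> X"
  obtains Q where "Q \<in> credal_set X P" "natural_extension X P A = Q A"
    "\<And>R. R \<in> credal_set X P \<Longrightarrow> R A \<le> Q A"
proof -
  define K where "K = Pi\<^sub>E UNIV (\<lambda>_. {0..1}) \<inter> credal_set X P"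
  have clip: "(\<lambda>B. if B \<subseteq> X then R B else 0) \<in> K" if "R \<in> credal_set X P" for R
  proof -
    have "finitely_additive_probability X R"
      using that by (simp add: credal_set_def)
    then have "0 \<le> R B" "R B \<le> 1" if "B \<subseteq> X" for B
      using that finitely_additive_probability_le_1 by (auto simp: finitely_additive_probability_def)
    moreover have "(\<lambda>B. if B \<subseteq> X then R B else 0) \<in> credal_set X P"
      using that by (simp add: credal_set_def finitely_additive_probability_def)
    ultimately show ?thesis by (auto simp: K_def)
  qed
  have "compactin (product_topology (\<lambda>_. euclidean) UNIV) (Pi\<^sub>E UNIV (\<lambda>_. {0..1::real}))"
    by (simp add: compactin_PiE)
  then have "compact (Pi\<^sub>E UNIV (\<lambda>_. {0..1}) :: ('a set \<Rightarrow> real) set)"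
    by (simp add: euclidean_product_topology)
  then have "compact K"
    unfolding K_def using closed_credal_set by (rule compact_Int_closed)
  moreover have "K \<noteq> {}"
    using assms(1) clip by (auto simp: avoids_sure_loss_def)
  moreover have "continuous_on K (\<lambda>Q. Q A)"
    by (rule continuous_on_product_coordinates[THEN continuous_on_subset]) simp
  ultimately obtain Q where Q: "Q \<in> K" "\<And>R. R \<in> K \<Longrightarrow> R A \<le> Q A"
    using continuous_attains_sup[of K "\<lambda>Q. Q A"] by blast
  have max: "R A \<le> Q A" if "R \<in> credal_set X P" for R
    using Q(2)[OF clip[OF that]] assms(2) by simp
  have "natural_extension X P A = Q A"
    unfolding natural_extension_def
    by (rule Greatest_equality) (use Q(1) max in \<open>auto simp: K_def\<close>)
  with Q(1) max that show thesis by (auto simp: K_def)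
qed

lemma natural_extension_le:
  assumes "avoids_sure_loss X P" "A \<subseteq> X"
  shows "natural_extension X P A \<le> P A"
proof -
  obtain Q where "Q \<in> credal_set X P" "natural_extension X P A = Q A"
    using natural_extension_attained[OF assms] .
  then show ?thesis
    using assms(2) by (simp add: credal_set_def)
qed

lemma credal_le_natural_extension:
  assumes "Q \<in> credal_set X P" "A \<subseteq> X"
  shows "Q A \<le> natural_extension X P A"
proof -
  have "avoids_sure_loss X P"
    using assms(1) by (auto simp: avoids_sure_loss_def)
  then obtain R where "natural_extension X P A = R A" "\<And>S. S \<in> credal_set X P \<Longrightarrow> S A \<le> R A"
    using natural_extension_attained[OF _ assms(2)] by blast
  then show ?thesis
    using assms(1) by simp
qed

lemma natural_extension_carrier:
  assumes "avoids_sure_loss X P"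
  shows "natural_extension X P X = 1"
proof -
  obtain Q where "Q \<in> credal_set X P" "natural_extension X P X = Q X"
    using natural_extension_attained[OF assms order_refl] .
  then show ?thesis
    by (simp add: credal_set_def finitely_additive_probability_def)
qed

section \<open>Dominated two-point measures\<close>

text \<open>Put mass \<open>p y\<close> at a maximizer \<open>y\<close> of \<open>p\<close> over \<open>A\<close> and the rest at a point \<open>z\<close> of
  possibility 1. An event containing \<open>z\<close> has possibility 1, so it is not constrained; any other event
  has mass at most \<open>p y\<close>, and only if it contains \<open>y\<close>.\<close>

lemma credal_set_attains_max_over:
  assumes "finite X" "possibility_distribution X p" "A \<subseteq> X"
  obtains Q where "Q \<in> credal_set X (max_over p)" "max_over p A \<le> Q A"
proof -
  have p: "\<And>x. x \<in> X \<Longrightarrow> 0 \<le> p x \<and> p x \<le> 1" and norm: "max_over p X = 1"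
    using assms(2) by (auto simp: possibility_distribution_def)
  obtain z where "z \<in> X" "max_over p X = p z"
    using max_over_attained[OF assms(1) possibility_distribution_carrier_nonempty[OF assms(2)]] .
  with norm have z: "z \<in> X" "p z = 1"
    by auto
  \<comment> \<open>Any point serves as \<open>y\<close> when \<open>A\<close> is empty, because the maximum is then 0 by convention.\<close>
  obtain y where y: "y \<in> X" "A \<noteq> {} \<Longrightarrow> y \<in> A \<and> max_over p A = p y"
  proof (cases "A = {}")
    case True
    then show thesis using that z(1) by blast
  next
    case False
    obtain y where "y \<in> A" "max_over p A = p y"
      using max_over_attained[OF finite_subset[OF assms(3,1)] False] .
    then show thesis using that assms(3) by blast
  qed
  define Q where "Q B = p y * indicator B y + (1 - p y) * indicator B z" for B :: "'a set"
  have "finitely_additive_probability X Q"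
    using p[OF y(1)] y(1) z(1)
    by (auto simp: finitely_additive_probability_def Q_def indicator_def)
  moreover have "Q B \<le> max_over p B" if "B \<subseteq> X" for B
  proof -
    have B: "finite B" using that assms(1) finite_subset by blast
    have "0 \<le> max_over p B"
      using max_over_nonneg[OF B] p that by blast
    then show ?thesis
      using p[OF y(1)] z(2) max_over_upper[OF B, of y p] max_over_upper[OF B, of z p]
      by (auto simp: Q_def indicator_def)
  qed
  ultimately have "Q \<in> credal_set X (max_over p)"
    by (simp add: credal_set_def)
  moreover have "max_over p A \<le> Q A"
  proof (cases "A = {}")
    case True
    then show ?thesis by (simp add: Q_def max_over_def)
  next
    case False
    then show ?thesis
      using y(2) p[OF y(1)] by (simp add: Q_def)
  qed
  ultimately show thesis by (rule that)
qed

lemma credal_set_mono: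
  assumes "\<And>A. A \<subseteq> X \<Longrightarrow> F A \<le> G A"
  shows "credal_set X F \<subseteq> credal_set X G"
proof
  fix Q assume "Q \<in> credal_set X F"
  then show "Q \<in> credal_set X G"
    using assms by (auto simp: credal_set_def intro: order_trans[of "Q B" "F B" "G B" for B])
qed

lemma natural_extension_ge_max_over:
  assumes "finite X" "possibility_distribution X p"
    and "\<And>A. A \<subseteq> X \<Longrightarrow> max_over p A \<le> P A"
  shows "avoids_sure_loss X P"
    and "A \<subseteq> X \<Longrightarrow> max_over p A \<le> natural_extension X P A"
proof -
  have sub: "credal_set X (max_over p) \<subseteq> credal_set X P"
    using assms(3) by (rule credal_set_mono)
  show "avoids_sure_loss X P"
    using credal_set_attains_max_over[OF assms(1,2) order_refl] sub
    by (auto simp: avoids_sure_loss_def)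
  assume A: "A \<subseteq> X"
  obtain Q where "Q \<in> credal_set X (max_over p)" "max_over p A \<le> Q A"
    using credal_set_attains_max_over[OF assms(1,2) A] .
  then show "max_over p A \<le> natural_extension X P A"
    using sub credal_le_natural_extension[of Q X P A] A by force
qed

section \<open>The minimum of two possibility measures\<close>

theorem lemma21:
  fixes X :: "'a set"
    and \<pi>\<^sub>1 \<pi>\<^sub>2 \<pi> :: "'a \<Rightarrow> real"
    and Poss\<^sub>1 Poss\<^sub>2 Poss P E :: "'a set \<Rightarrow> real"
  assumes "finite X"
    and "possibility_distribution X \<pi>\<^sub>1"
    and "possibility_distribution X \<pi>\<^sub>2"
    and "\<And>A. A \<subseteq> X \<Longrightarrow> Poss\<^sub>1 A = max_over \<pi>\<^sub>1 A"
    and "\<And>A. A \<subseteq> X \<Longrightarrow> Poss\<^sub>2 A = max_over \<pi>\<^sub>2 A"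
    and "\<And>A. A \<subseteq> X \<Longrightarrow> P A = min (Poss\<^sub>1 A) (Poss\<^sub>2 A)"
    and "\<And>A. A \<subseteq> X \<Longrightarrow> E A = natural_extension X P A"
    and "\<And>x. x \<in> X \<Longrightarrow> \<pi> x = min (\<pi>\<^sub>1 x) (\<pi>\<^sub>2 x)"
    and "\<And>A. A \<subseteq> X \<Longrightarrow> Poss A = max_over \<pi> A"
  shows "(\<forall>x\<in>X. \<pi> x = P {x}) \<and>
         (\<forall>A\<subseteq>X. P A \<ge> Poss A) \<and>
         ((normed X Poss \<longleftrightarrow> (\<exists>x\<in>X. P {x} = 1)) \<and>
          (normed X Poss \<longrightarrow>
             avoids_sure_loss X P \<and> (\<forall>A\<subseteq>X. P A \<ge> E A \<and> E A \<ge> Poss A))) \<and>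
         (possibility_measure X P \<longleftrightarrow> (\<forall>A\<subseteq>X. P A = Poss A)) \<and>
         (avoids_sure_loss X P \<and> possibility_measure X E \<longleftrightarrow>
          avoids_sure_loss X P \<and> (\<forall>A\<subseteq>X. E A = Poss A))"
proof -
  have fin: "\<And>A. A \<subseteq> X \<Longrightarrow> finite A"
    using assms(1) finite_subset by blast
  have nonempty: "X \<noteq> {}"
    using assms(2) by (rule possibility_distribution_carrier_nonempty)
  have unit: "\<And>x. x \<in> X \<Longrightarrow> \<pi> x \<in> {0..1}"
    using assms(2,3,8) by (auto simp: possibility_distribution_def)
  have P: "\<And>A. A \<subseteq> X \<Longrightarrow> P A = min (max_over \<pi>\<^sub>1 A) (max_over \<pi>\<^sub>2 A)"
    using assms(4-6) by simp
  have singleton: "\<And>x. x \<in> X \<Longrightarrow> P {x} = \<pi> x"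
    using P assms(8) by simp
  have P_ge: "max_over \<pi> A \<le> P A" if "A \<subseteq> X" for A
    using that assms(8) max_over_mono[OF fin[OF that], of \<pi> \<pi>\<^sub>1]
      max_over_mono[OF fin[OF that], of \<pi> \<pi>\<^sub>2] by (auto simp: P subset_iff)
  have P_carrier: "P X = 1"
    using P assms(2,3) by (simp add: possibility_distribution_def)
  have normed_iff: "normed X Poss \<longleftrightarrow> possibility_distribution X \<pi>"
    using unit assms(9) by (simp add: normed_def possibility_distribution_def)
  have normed_witness: "normed X Poss \<longleftrightarrow> (\<exists>x\<in>X. \<pi> x = 1)"
  proof
    assume "normed X Poss"
    then show "\<exists>x\<in>X. \<pi> x = 1"
      using max_over_attained[OF assms(1) nonempty, of \<pi>] assms(9)[OF order_refl]
      by (auto simp: normed_def)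
  next
    assume "\<exists>x\<in>X. \<pi> x = 1"
    then obtain x where "x \<in> X" "\<pi> x = 1" ..
    then have "1 \<le> max_over \<pi> X"
      using max_over_upper[OF assms(1), of x \<pi>] by simp
    moreover have "max_over \<pi> X \<le> 1"
      using P_ge[OF order_refl] P_carrier by simp
    ultimately show "normed X Poss"
      using assms(9) by (simp add: normed_def)
  qed
  have E_le: "E A \<le> P A" if "avoids_sure_loss X P" "A \<subseteq> X" for A
    using natural_extension_le[OF that] assms(7)[OF that(2)] by simp
  have normed_E: "avoids_sure_loss X P \<and> (\<forall>A\<subseteq>X. E A \<le> P A \<and> Poss A \<le> E A)"
    if "normed X Poss"
    using natural_extension_ge_max_over[OF assms(1) _ P_ge] that E_le assms(7,9)
    by (simp add: normed_iff)
  have Poss_possibility: "possibility_measure X F"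
    if "F X = 1" "\<forall>A\<subseteq>X. F A = Poss A" for F
  proof -
    have "possibility_distribution X \<pi>"
      using that normed_iff by (simp add: normed_def)
    then show ?thesis
      using that(2) assms(9) by (auto simp: possibility_measure_def)
  qed
  have "P A = Poss A" if "possibility_measure X P" "A \<subseteq> X" for A
    using possibility_measure_eq_max_over_singletons[OF that] that(2) singleton assms(9)
      max_over_cong[of A "\<lambda>x. P {x}" \<pi>] by (simp add: subset_iff)
  then have c: "possibility_measure X P \<longleftrightarrow> (\<forall>A\<subseteq>X. P A = Poss A)"
    using Poss_possibility P_carrier by blast
  have "E A = Poss A"
    if asl: "avoids_sure_loss X P" and poss: "possibility_measure X E" and A: "A \<subseteq> X" for A
  proof -
    \<comment> \<open>A possibility measure is no larger than \<open>Poss\<close> as soon as it is so on singletons.\<close>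
    have E_Poss: "E B \<le> Poss B" if B: "B \<subseteq> X" for B
    proof -
      have "E {x} \<le> \<pi> x" if "x \<in> B" for x
        using E_le[OF asl, of "{x}"] singleton that B by auto
      then show ?thesis
        using max_over_mono[OF fin[OF B], of "\<lambda>x. E {x}" \<pi>]
          possibility_measure_eq_max_over_singletons[OF poss B] assms(9)[OF B] by simp
    qed
    have "normed X Poss"
      using E_Poss[of X] possibility_measure_carrier[OF poss] P_ge[of X] P_carrier assms(9)
      by (simp add: normed_def)
    then show ?thesis
      using normed_E E_Poss A by (meson order_antisym)
  qed
  moreover have "E X = 1" if "avoids_sure_loss X P"
    using natural_extension_carrier[OF that] assms(7) by simp
  ultimately have d: "avoids_sure_loss X P \<and> possibility_measure X E \<longleftrightarrow>
      avoids_sure_loss X P \<and> (\<forall>A\<subseteq>X. E A = Poss A)"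
    using Poss_possibility by blast
  show ?thesis
    using singleton P_ge assms(9) normed_witness normed_E c d by simp
qed

end
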